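(* Let $\iota\colon\mathbf{A}\to\mathbf{B}$ be an isomorphism of commutative bimonoids, and let $e_A\colon\mathbf{A}\hookrightarrow\overline{\mathbf{A}}$ and $e_B\colon\mathbf{B}\hookrightarrow\overline{\mathbf{B}}$ be commutative bimonoids of fractions of $\mathbf{A}$ and $\mathbf{B}$. If $\overline{\mathbf{B}}$ is complemented, then there is a unique embedding of bimonoids $\overline{\iota}\colon\overline{\mathbf{A}}\to\overline{\mathbf{B}}$ extending $\iota$, i.e.\ with $\overline{\iota}\circ e_A=e_B\circ\iota$.
   Context: A bimonoid $\langle A,\leq,\cdot,1,+,0\rangle$ is a poset with two monoid structures ($\cdot$ with unit $1$, $+$ with unit $0$), both operations order preserving in each argument, satisfying hemidistributivity $x\cdot(y+z)\leq(x\cdot y)+z$ and $(z+y)\cdot x\leq z+(y\cdot x)$; commutative if both operations are commutative. Homomorphisms preserve order, $\cdot,1,+,0$; embeddings are homomorphisms that are order embeddings. In a commutative bimonoid, $y$ is a complement of $x$ if $x\cdot y\leq 0$ and $1\leq x+y$; unique if it exists, written $\overline{x}$; complemented means every element has a complement. A commutative bimonoid $\mathbf{C}$ together with an embedding $e\colon\mathbf{A}\hookrightarrow\mathbf{C}$ is a commutative bimonoid of fractions of $\mathbf{A}$ if every element of $\mathbf{C}$ can be written both as $e(a)\cdot\overline{e(b)}$ and as $e(c)+\overline{e(d)}$ for some $a,b,c,d\in\mathbf{A}$ (with the relevant complements existing in $\mathbf{C}$). *)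

theory Defs
  imports "HOL-Algebra.Ring"
begin

text \<open>The two monoids reuse the signature of \<^typ>\<open>'a ring\<close>: \<open>\<otimes>\<close>, \<open>\<one>\<close> and \<open>\<oplus>\<close>, \<open>\<zero>\<close>;
  none of the ring axioms is assumed.\<close>

record 'a bimonoid = "'a ring" +
  bm_le :: "['a, 'a] \<Rightarrow> bool" (infix \<open>\<preceq>\<index>\<close> 50)

locale bimonoid =
  fixes A (structure)
  assumes le_refl: "reflp_on (carrier A) (\<preceq>)"
    and le_antisym: "antisymp_on (carrier A) (\<preceq>)"
    and le_trans: "transp_on (carrier A) (\<preceq>)"
    and mult_monoid: "monoid A"
    and plus_monoid: "monoid (add_monoid A)"
    and mult_mono:
      "\<lbrakk>x \<in> carrier A; x' \<in> carrier A; y \<in> carrier A; y' \<in> carrier A; x \<preceq> x'; y \<preceq> y'\<rbrakk>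
        \<Longrightarrow> x \<otimes> y \<preceq> x' \<otimes> y'"
    and plus_mono:
      "\<lbrakk>x \<in> carrier A; x' \<in> carrier A; y \<in> carrier A; y' \<in> carrier A; x \<preceq> x'; y \<preceq> y'\<rbrakk>
        \<Longrightarrow> x \<oplus> y \<preceq> x' \<oplus> y'"
    and hemidistrib_left:
      "\<lbrakk>x \<in> carrier A; y \<in> carrier A; z \<in> carrier A\<rbrakk>
        \<Longrightarrow> x \<otimes> (y \<oplus> z) \<preceq> (x \<otimes> y) \<oplus> z"
    and hemidistrib_right:
      "\<lbrakk>x \<in> carrier A; y \<in> carrier A; z \<in> carrier A\<rbrakk>
        \<Longrightarrow> (z \<oplus> y) \<otimes> x \<preceq> z \<oplus> (y \<otimes> x)"

locale comm_bimonoid = bimonoid +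
  assumes mult_comm: "\<lbrakk>x \<in> carrier A; y \<in> carrier A\<rbrakk> \<Longrightarrow> x \<otimes> y = y \<otimes> x"
    and plus_comm: "\<lbrakk>x \<in> carrier A; y \<in> carrier A\<rbrakk> \<Longrightarrow> x \<oplus> y = y \<oplus> x"

definition bimonoid_hom ::
  "('a, 'm) bimonoid_scheme \<Rightarrow> ('b, 'n) bimonoid_scheme \<Rightarrow> ('a \<Rightarrow> 'b) \<Rightarrow> bool" where
  "bimonoid_hom A B h \<longleftrightarrow>
     h \<in> carrier A \<rightarrow> carrier B \<and>
     (\<forall>x\<in>carrier A. \<forall>y\<in>carrier A. x \<preceq>\<^bsub>A\<^esub> y \<longrightarrow> h x \<preceq>\<^bsub>B\<^esub> h y) \<and>
     (\<forall>x\<in>carrier A. \<forall>y\<in>carrier A. h (x \<otimes>\<^bsub>A\<^esub> y) = h x \<otimes>\<^bsub>B\<^esub> h y) \<and>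
     h \<one>\<^bsub>A\<^esub> = \<one>\<^bsub>B\<^esub> \<and>
     (\<forall>x\<in>carrier A. \<forall>y\<in>carrier A. h (x \<oplus>\<^bsub>A\<^esub> y) = h x \<oplus>\<^bsub>B\<^esub> h y) \<and>
     h \<zero>\<^bsub>A\<^esub> = \<zero>\<^bsub>B\<^esub>"

definition bimonoid_embedding ::
  "('a, 'm) bimonoid_scheme \<Rightarrow> ('b, 'n) bimonoid_scheme \<Rightarrow> ('a \<Rightarrow> 'b) \<Rightarrow> bool" where
  "bimonoid_embedding A B h \<longleftrightarrow>
     bimonoid_hom A B h \<and>
     (\<forall>x\<in>carrier A. \<forall>y\<in>carrier A. x \<preceq>\<^bsub>A\<^esub> y \<longleftrightarrow> h x \<preceq>\<^bsub>B\<^esub> h y)"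

definition bimonoid_iso ::
  "('a, 'm) bimonoid_scheme \<Rightarrow> ('b, 'n) bimonoid_scheme \<Rightarrow> ('a \<Rightarrow> 'b) \<Rightarrow> bool" where
  "bimonoid_iso A B h \<longleftrightarrow>
     bimonoid_hom A B h \<and> bij_betw h (carrier A) (carrier B) \<and>
     bimonoid_hom B A (inv_into (carrier A) h)"

definition is_complement :: "('a, 'm) bimonoid_scheme \<Rightarrow> 'a \<Rightarrow> 'a \<Rightarrow> bool" where
  "is_complement A x y \<longleftrightarrow>
     y \<in> carrier A \<and> x \<otimes>\<^bsub>A\<^esub> y \<preceq>\<^bsub>A\<^esub> \<zero>\<^bsub>A\<^esub> \<and> \<one>\<^bsub>A\<^esub> \<preceq>\<^bsub>A\<^esub> x \<oplus>\<^bsub>A\<^esub> y"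

definition has_complement :: "('a, 'm) bimonoid_scheme \<Rightarrow> 'a \<Rightarrow> bool" where
  "has_complement A x \<longleftrightarrow> (\<exists>y. is_complement A x y)"

definition bm_compl :: "('a, 'm) bimonoid_scheme \<Rightarrow> 'a \<Rightarrow> 'a" where
  "bm_compl A x = (THE y. is_complement A x y)"

definition complemented :: "('a, 'm) bimonoid_scheme \<Rightarrow> bool" where
  "complemented A \<longleftrightarrow> (\<forall>x\<in>carrier A. has_complement A x)"

definition comm_bimonoid_of_fractions ::
  "('a, 'm) bimonoid_scheme \<Rightarrow> ('c, 'n) bimonoid_scheme \<Rightarrow> ('a \<Rightarrow> 'c) \<Rightarrow> bool" where
  "comm_bimonoid_of_fractions A C e \<longleftrightarrow>
     comm_bimonoid A \<and> comm_bimonoid C \<and> bimonoid_embedding A C e \<and>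
     (\<forall>x\<in>carrier C.
        (\<exists>a\<in>carrier A. \<exists>b\<in>carrier A.
           has_complement C (e b) \<and> x = e a \<otimes>\<^bsub>C\<^esub> bm_compl C (e b)) \<and>
        (\<exists>c\<in>carrier A. \<exists>d\<in>carrier A.
           has_complement C (e d) \<and> x = e c \<oplus>\<^bsub>C\<^esub> bm_compl C (e d)))"

context comm_bimonoid
begin

lemma complement_le:
  assumes x: "x \<in> carrier A" and y: "is_complement A x y" and z: "is_complement A x z"
  shows "y \<preceq> z"
proof -
  have c: "y \<in> carrier A" "z \<in> carrier A"
    using y z by (simp_all add: is_complement_def)
  have cl: "a \<oplus> b \<in> carrier A" if "a \<in> carrier A" "b \<in> carrier A" for a b
    using monoid.m_closed[OF plus_monoid, of a b] that by simp
  have mc: "a \<otimes> b \<in> carrier A" if "a \<in> carrier A" "b \<in> carrier A" for a b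
    using monoid.m_closed[OF mult_monoid] that .
  have zc: "\<zero> \<in> carrier A" using monoid.one_closed[OF plus_monoid] by simp
  have oc: "\<one> \<in> carrier A" by (rule monoid.one_closed[OF mult_monoid])
  have 0: "y \<otimes> \<one> = y" by (rule monoid.r_one[OF mult_monoid c(1)])
  have 1: "y \<preceq> y \<otimes> (x \<oplus> z)"
    using mult_mono[OF c(1) c(1) oc cl[OF x c(2)] reflp_onD[OF le_refl c(1)]] z
    by (simp add: is_complement_def 0)
  have 2: "y \<otimes> (x \<oplus> z) \<preceq> (y \<otimes> x) \<oplus> z"
    by (rule hemidistrib_left[OF c(1) x c(2)])
  have yx: "y \<otimes> x \<preceq> \<zero>"
    using y unfolding is_complement_def mult_comm[OF c(1) x] by simp
  have 4: "\<zero> \<oplus> z = z" using monoid.l_one[OF plus_monoid, of z] c by simp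
  have 3: "(y \<otimes> x) \<oplus> z \<preceq> z"
    using plus_mono[OF mc[OF c(1) x] zc c(2) c(2) yx reflp_onD[OF le_refl c(2)]]
    unfolding 4 .
  have "y \<preceq> (y \<otimes> x) \<oplus> z"
    by (rule transp_onD[OF le_trans c(1) mc[OF c(1) cl[OF x c(2)]] cl[OF mc[OF c(1) x] c(2)] 1 2])
  then show ?thesis
    by (rule transp_onD[OF le_trans c(1) cl[OF mc[OF c(1) x] c(2)] c(2) _ 3])
qed

lemma complement_unique:
  assumes x: "x \<in> carrier A" and y: "is_complement A x y" and z: "is_complement A x z"
  shows "y = z"
proof (rule antisymp_onD[OF le_antisym])
  show "y \<in> carrier A" "z \<in> carrier A" using y z by (simp_all add: is_complement_def)
qed (rule complement_le[OF x y z], rule complement_le[OF x z y])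

lemma bm_compl_eq:
  assumes x: "x \<in> carrier A" and y: "is_complement A x y"
  shows "bm_compl A x = y"
  unfolding bm_compl_def by (rule the_equality, rule y, rule complement_unique[OF x _ y])

end

end

theory Submission
  imports Defs
begin

text \<open>Identify \<open>A\<close> with \<open>B\<close>, so that \<open>C\<close> and \<open>D\<close> are bimonoids of fractions of the same \<open>A\<close>,
  via \<open>e\<close> and \<open>f\<close>, with \<open>D\<close> complemented. By residuation, a multiplicative fraction \<open>a \<cdot> b'\<close> lies
  below an additive one \<open>c + d'\<close> iff \<open>a \<cdot> d \<le> b + c\<close> holds in \<open>A\<close>, a condition that does not depend
  on the ambient bimonoid. So \<open>a \<cdot> b' \<mapsto> a \<cdot> b'\<close> is an order embedding of \<open>C\<close> into \<open>D\<close> as soon as an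
  equality \<open>x = a \<cdot> b' = c + d'\<close> in \<open>C\<close> persists in \<open>D\<close>. The inequality \<open>c + d' \<le> a \<cdot> b'\<close> is the
  hard half: in \<open>D\<close> rewrite it as \<open>p \<cdot> q' \<le> r + s'\<close>. The inequalities \<open>p \<cdot> q' \<le> c + d'\<close> and
  \<open>a \<cdot> b' \<le> r + s'\<close> pass to \<open>C\<close> as \<open>p \<le> x + q\<close> and \<open>x \<cdot> s \<le> r\<close>, even though \<open>q'\<close> and \<open>s'\<close> need not
  exist there, and hemidistributivity gives \<open>p \<cdot> s \<le> (x + q) \<cdot> s \<le> q + r\<close>.\<close>

section \<open>Monoid and order laws of a bimonoid\<close>

context bimonoid
begin

lemma mult_closed [simp]: "\<lbrakk>x \<in> carrier A; y \<in> carrier A\<rbrakk> \<Longrightarrow> x \<otimes> y \<in> carrier A"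
  by (rule monoid.m_closed[OF mult_monoid])

lemma plus_closed [simp]: "\<lbrakk>x \<in> carrier A; y \<in> carrier A\<rbrakk> \<Longrightarrow> x \<oplus> y \<in> carrier A"
  using monoid.m_closed[OF plus_monoid, of x y] by simp

lemma unit_closed [simp]: "\<one> \<in> carrier A"
  by (rule monoid.one_closed[OF mult_monoid])

lemma null_closed [simp]: "\<zero> \<in> carrier A"
  using monoid.one_closed[OF plus_monoid] by simp

lemma mult_unit [simp]: "x \<in> carrier A \<Longrightarrow> x \<otimes> \<one> = x" "x \<in> carrier A \<Longrightarrow> \<one> \<otimes> x = x"
  by (simp_all add: monoid.r_one[OF mult_monoid] monoid.l_one[OF mult_monoid])

lemma plus_null [simp]: "x \<in> carrier A \<Longrightarrow> x \<oplus> \<zero> = x" "x \<in> carrier A \<Longrightarrow> \<zero> \<oplus> x = x"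
  using monoid.r_one[OF plus_monoid, of x] monoid.l_one[OF plus_monoid, of x] by simp_all

lemma mult_assoc:
  "\<lbrakk>x \<in> carrier A; y \<in> carrier A; z \<in> carrier A\<rbrakk> \<Longrightarrow> x \<otimes> y \<otimes> z = x \<otimes> (y \<otimes> z)"
  by (rule monoid.m_assoc[OF mult_monoid])

lemma plus_assoc:
  "\<lbrakk>x \<in> carrier A; y \<in> carrier A; z \<in> carrier A\<rbrakk> \<Longrightarrow> x \<oplus> y \<oplus> z = x \<oplus> (y \<oplus> z)"
  using monoid.m_assoc[OF plus_monoid, of x y z] by simp

lemma le_self [simp]: "x \<in> carrier A \<Longrightarrow> x \<preceq> x"
  by (rule reflp_onD[OF le_refl])

lemma le_transD:
  "\<lbrakk>x \<preceq> y; y \<preceq> z; x \<in> carrier A; y \<in> carrier A; z \<in> carrier A\<rbrakk> \<Longrightarrow> x \<preceq> z"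
  by (rule transp_onD[OF le_trans])

lemma le_antisymD: "\<lbrakk>x \<preceq> y; y \<preceq> x; x \<in> carrier A; y \<in> carrier A\<rbrakk> \<Longrightarrow> x = y"
  by (rule antisymp_onD[OF le_antisym])

end

section \<open>Complements and residuation\<close>

context comm_bimonoid
begin

lemma mult_left_comm:
  "\<lbrakk>x \<in> carrier A; y \<in> carrier A; z \<in> carrier A\<rbrakk> \<Longrightarrow> x \<otimes> (y \<otimes> z) = y \<otimes> (x \<otimes> z)"
  by (metis mult_assoc mult_comm)

lemma plus_left_comm:
  "\<lbrakk>x \<in> carrier A; y \<in> carrier A; z \<in> carrier A\<rbrakk> \<Longrightarrow> x \<oplus> (y \<oplus> z) = y \<oplus> (x \<oplus> z)"
  by (metis plus_assoc plus_comm)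

lemma is_complement_sym:
  "\<lbrakk>x \<in> carrier A; is_complement A x y\<rbrakk> \<Longrightarrow> is_complement A y x"
  by (auto simp: is_complement_def mult_comm plus_comm)

lemma is_complement_closed: "is_complement A x y \<Longrightarrow> y \<in> carrier A"
  by (simp add: is_complement_def)

lemma is_complement_bm_compl:
  "\<lbrakk>x \<in> carrier A; has_complement A x\<rbrakk> \<Longrightarrow> is_complement A x (bm_compl A x)"
  using bm_compl_eq unfolding has_complement_def by metis

text \<open>This presents each element of the base as a multiplicative fraction with denominator
  \<zero>.\<close>

lemma is_complement_zero_one: "is_complement A \<zero> \<one>"
  by (simp add: is_complement_def)

text \<open>A De Morgan law. Hemidistributivity cancels \<open>y\<close> against \<open>y'\<close>
  first, giving y \<otimes> (y' \<oplus> x') \<preceq> x' and x \<preceq> (x \<otimes> y) \<oplus>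
  y'. Multiplying the former by \<open>x\<close> and adding \<open>x'\<close> to the latter then
  cancels \<open>x\<close> against \<open>x'\<close>.\<close>

lemma is_complement_mult:
  assumes x: "x \<in> carrier A" and y: "y \<in> carrier A"
    and x': "is_complement A x x'" and y': "is_complement A y y'"
  shows "is_complement A (x \<otimes> y) (x' \<oplus> y')"
proof -
  have c [simp]: "x \<in> carrier A" "y \<in> carrier A" "x' \<in> carrier A" "y' \<in> carrier A"
    using assms by (auto dest: is_complement_closed)
  have xx: "x \<otimes> x' \<preceq> \<zero>" "\<one> \<preceq> x \<oplus> x'" and yy: "y \<otimes> y' \<preceq> \<zero>" "\<one> \<preceq> y \<oplus> y'"
    using x' y' by (auto simp: is_complement_def)
  have "y \<otimes> (y' \<oplus> x') \<preceq> (y \<otimes> y') \<oplus> x'"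
    by (simp add: hemidistrib_left)
  moreover have "(y \<otimes> y') \<oplus> x' \<preceq> x'"
    using plus_mono[of "y \<otimes> y'" \<zero> x' x'] yy by simp
  ultimately have "y \<otimes> (y' \<oplus> x') \<preceq> x'"
    by (rule le_transD) simp_all
  then have "x \<otimes> (y \<otimes> (y' \<oplus> x')) \<preceq> x \<otimes> x'"
    by (intro mult_mono) simp_all
  then have 1: "x \<otimes> y \<otimes> (x' \<oplus> y') \<preceq> \<zero>"
    using le_transD[OF _ xx(1)] by (simp add: mult_assoc plus_comm)
  have "x \<preceq> x \<otimes> (y \<oplus> y')"
    using mult_mono[of x x \<one> "y \<oplus> y'"] yy by simp
  moreover have "x \<otimes> (y \<oplus> y') \<preceq> (x \<otimes> y) \<oplus> y'"
    by (simp add: hemidistrib_left)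
  ultimately have "x \<preceq> (x \<otimes> y) \<oplus> y'"
    by (rule le_transD) simp_all
  then have "x \<oplus> x' \<preceq> (x \<otimes> y) \<oplus> y' \<oplus> x'"
    by (intro plus_mono) simp_all
  then have 2: "\<one> \<preceq> (x \<otimes> y) \<oplus> (x' \<oplus> y')"
    using le_transD[OF xx(2)] by (simp add: plus_assoc plus_comm plus_left_comm)
  show ?thesis
    using 1 2 by (simp add: is_complement_def)
qed

text \<open>The previous law applied to \<open>x'\<close> and \<open>y'\<close>, read backwards by
  the symmetry of complementation.\<close>

lemma is_complement_plus:
  assumes x: "x \<in> carrier A" and y: "y \<in> carrier A"
    and x': "is_complement A x x'" and y': "is_complement A y y'"
  shows "is_complement A (x \<oplus> y) (x' \<otimes> y')"
  using assms by (meson is_complement_closed is_complement_mult is_complement_sym mult_closed)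

text \<open>Residuation: multiplication by \<open>y'\<close> is left adjoint to addition of
  \<open>y\<close>. The unit is x \<preceq> x \<otimes> (y' \<oplus> y) \<preceq> (x \<otimes> y')
  \<oplus> y and the counit is y' \<otimes> (y \<oplus> z) \<preceq> (y' \<otimes> y) \<oplus> z
  \<preceq> z.\<close>

lemma mult_compl_le_iff:
  assumes [simp]: "x \<in> carrier A" "y \<in> carrier A" "z \<in> carrier A" and y': "is_complement A y y'"
  shows "x \<otimes> y' \<preceq> z \<longleftrightarrow> x \<preceq> y \<oplus> z"
proof
  have c [simp]: "y' \<in> carrier A" and yy: "y \<otimes> y' \<preceq> \<zero>" "\<one> \<preceq> y \<oplus> y'"
    using y' by (auto simp: is_complement_def)
  show "x \<preceq> y \<oplus> z" if "x \<otimes> y' \<preceq> z"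
  proof -
    have "x \<preceq> x \<otimes> (y' \<oplus> y)"
      using mult_mono[of x x \<one> "y \<oplus> y'"] yy by (simp add: plus_comm)
    moreover have "x \<otimes> (y' \<oplus> y) \<preceq> (x \<otimes> y') \<oplus> y"
      by (simp add: hemidistrib_left)
    ultimately have "x \<preceq> (x \<otimes> y') \<oplus> y"
      by (rule le_transD) simp_all
    moreover have "(x \<otimes> y') \<oplus> y \<preceq> z \<oplus> y"
      using that by (intro plus_mono) simp_all
    ultimately have "x \<preceq> z \<oplus> y"
      by (rule le_transD) simp_all
    then show ?thesis by (simp add: plus_comm)
  qed
  show "x \<otimes> y' \<preceq> z" if "x \<preceq> y \<oplus> z"
  proof -
    have "x \<otimes> y' \<preceq> y' \<otimes> (y \<oplus> z)"
      using mult_mono[of x "y \<oplus> z" y' y'] that by (simp add: mult_comm)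
    moreover have "y' \<otimes> (y \<oplus> z) \<preceq> (y' \<otimes> y) \<oplus> z"
      by (simp add: hemidistrib_left)
    ultimately have "x \<otimes> y' \<preceq> (y' \<otimes> y) \<oplus> z"
      by (rule le_transD) simp_all
    moreover have "(y' \<otimes> y) \<oplus> z \<preceq> z"
      using plus_mono[of "y' \<otimes> y" \<zero> z z] yy by (simp add: mult_comm)
    ultimately show ?thesis
      by (rule le_transD) simp_all
  qed
qed

text \<open>The same adjunction with \<open>y\<close> and \<open>y'\<close> exchanged, as
  \<open>y\<close> is a complement of \<open>y'\<close>.\<close>

lemma le_plus_compl_iff:
  assumes "x \<in> carrier A" "y \<in> carrier A" "z \<in> carrier A" "is_complement A y y'"
  shows "x \<preceq> z \<oplus> y' \<longleftrightarrow> x \<otimes> y \<preceq> z"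
  using mult_compl_le_iff[OF assms(1) _ assms(3) is_complement_sym[OF assms(2,4)]] assms
  by (simp add: is_complement_closed plus_comm)

text \<open>Two residuations move \<open>b'\<close> and \<open>d'\<close> across the inequality, so
  the criterion mentions no complement and can be tested in the base.\<close>

lemma fraction_le_iff:
  assumes "a \<in> carrier A" "b \<in> carrier A" "c \<in> carrier A" "d \<in> carrier A"
    and "is_complement A b b'" "is_complement A d d'"
  shows "a \<otimes> b' \<preceq> c \<oplus> d' \<longleftrightarrow> a \<otimes> d \<preceq> b \<oplus> c"
  using assms mult_compl_le_iff[of a b "c \<oplus> d'" b'] le_plus_compl_iff[of a d "b \<oplus> c" d']
  by (simp add: is_complement_closed plus_assoc)

end

section \<open>Transport along homomorphisms and isomorphisms\<close>

text \<open>The two defining inequalities involve only operations and constants that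
  \<open>h\<close> preserves. This later forces the value of a homomorphism on fractions.\<close>

lemma bimonoid_hom_is_complement:
  assumes "bimonoid A" "bimonoid_hom A B h" "x \<in> carrier A" "is_complement A x y"
  shows "is_complement B (h x) (h y)"
proof -
  interpret bimonoid A by fact
  have "y \<in> carrier A" "x \<otimes>\<^bsub>A\<^esub> y \<preceq>\<^bsub>A\<^esub> \<zero>\<^bsub>A\<^esub>" "\<one>\<^bsub>A\<^esub> \<preceq>\<^bsub>A\<^esub> x \<oplus>\<^bsub>A\<^esub> y"
    using assms(4) by (auto simp: is_complement_def)
  moreover have "h u \<preceq>\<^bsub>B\<^esub> h v" if "u \<in> carrier A" "v \<in> carrier A" "u \<preceq>\<^bsub>A\<^esub> v" for u v
    using assms(2) that by (simp add: bimonoid_hom_def)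
  ultimately have "h (x \<otimes>\<^bsub>A\<^esub> y) \<preceq>\<^bsub>B\<^esub> h \<zero>\<^bsub>A\<^esub>" "h \<one>\<^bsub>A\<^esub> \<preceq>\<^bsub>B\<^esub> h (x \<oplus>\<^bsub>A\<^esub> y)"
    using assms(3) by simp_all
  then show ?thesis
    using assms(2,3) \<open>y \<in> carrier A\<close> by (simp add: bimonoid_hom_def is_complement_def Pi_iff)
qed

text \<open>A bijective homomorphism need not reflect the order; here reflection comes from the
  monotonicity of the inverse.\<close>

lemma bimonoid_embedding_comp_iso:
  assumes "bimonoid_iso A B \<iota>" "bimonoid_embedding B D f"
  shows "bimonoid_embedding A D (f \<circ> \<iota>)"
proof -
  have i: "bimonoid_hom A B \<iota>" "bij_betw \<iota> (carrier A) (carrier B)"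
      "bimonoid_hom B A (inv_into (carrier A) \<iota>)"
    using assms(1) by (auto simp: bimonoid_iso_def)
  have closed: "\<iota> x \<in> carrier B" if "x \<in> carrier A" for x
    using i(2) that by (auto simp: bij_betw_def)
  have "x \<preceq>\<^bsub>A\<^esub> y \<longleftrightarrow> \<iota> x \<preceq>\<^bsub>B\<^esub> \<iota> y" if "x \<in> carrier A" "y \<in> carrier A" for x y
  proof
    show "\<iota> x \<preceq>\<^bsub>B\<^esub> \<iota> y" if "x \<preceq>\<^bsub>A\<^esub> y"
      using i(1) that \<open>x \<in> carrier A\<close> \<open>y \<in> carrier A\<close> by (auto simp: bimonoid_hom_def)
    assume "\<iota> x \<preceq>\<^bsub>B\<^esub> \<iota> y"
    then have "inv_into (carrier A) \<iota> (\<iota> x) \<preceq>\<^bsub>A\<^esub> inv_into (carrier A) \<iota> (\<iota> y)"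
      using i(3) closed that by (simp add: bimonoid_hom_def)
    then show "x \<preceq>\<^bsub>A\<^esub> y"
      using i(2) that by (simp add: bij_betw_inv_into_left)
  qed
  with i(1) assms(2) closed show ?thesis
    by (simp add: bimonoid_embedding_def bimonoid_hom_def Pi_iff)
qed

text \<open>Surjectivity of \<iota> lets every numerator and denominator in \<open>B\<close> be
  named by an element of \<open>A\<close>, which reduces the theorem to a single base.\<close>

lemma comm_bimonoid_of_fractions_comp_iso:
  assumes A: "comm_bimonoid A" and iso: "bimonoid_iso A B \<iota>"
    and frac: "comm_bimonoid_of_fractions B D f"
  shows "comm_bimonoid_of_fractions A D (f \<circ> \<iota>)"
proof -
  have "carrier B = \<iota> ` carrier A"
    using iso by (auto simp: bimonoid_iso_def bij_betw_def)
  moreover have "bimonoid_embedding A D (f \<circ> \<iota>)"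
    using iso frac bimonoid_embedding_comp_iso
    unfolding comm_bimonoid_of_fractions_def by blast
  ultimately show ?thesis
    using A frac by (simp add: comm_bimonoid_of_fractions_def)
qed

section \<open>Two bimonoids of fractions of one base, the second complemented\<close>

locale fractions_extension =
  A: comm_bimonoid A + C: comm_bimonoid C + D: comm_bimonoid D
  for A :: "('a, 'k) bimonoid_scheme" and C :: "('c, 'm) bimonoid_scheme"
    and D :: "('d, 'n) bimonoid_scheme" +
  fixes e :: "'a \<Rightarrow> 'c" and f :: "'a \<Rightarrow> 'd"
  assumes C_fractions: "comm_bimonoid_of_fractions A C e"
    and D_fractions: "comm_bimonoid_of_fractions A D f"
    and D_complemented: "complemented D"
begin

lemma e_simps [simp]:
  "a \<in> carrier A \<Longrightarrow> e a \<in> carrier C"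
  "\<lbrakk>a \<in> carrier A; b \<in> carrier A\<rbrakk> \<Longrightarrow> e (a \<otimes>\<^bsub>A\<^esub> b) = e a \<otimes>\<^bsub>C\<^esub> e b"
  "\<lbrakk>a \<in> carrier A; b \<in> carrier A\<rbrakk> \<Longrightarrow> e (a \<oplus>\<^bsub>A\<^esub> b) = e a \<oplus>\<^bsub>C\<^esub> e b"
  "e \<one>\<^bsub>A\<^esub> = \<one>\<^bsub>C\<^esub>" "e \<zero>\<^bsub>A\<^esub> = \<zero>\<^bsub>C\<^esub>"
  and e_le_iff: "\<lbrakk>a \<in> carrier A; b \<in> carrier A\<rbrakk> \<Longrightarrow> e a \<preceq>\<^bsub>C\<^esub> e b \<longleftrightarrow> a \<preceq>\<^bsub>A\<^esub> b"
  using C_fractions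
  by (auto simp: comm_bimonoid_of_fractions_def bimonoid_embedding_def bimonoid_hom_def)

lemma f_simps [simp]:
  "a \<in> carrier A \<Longrightarrow> f a \<in> carrier D"
  "\<lbrakk>a \<in> carrier A; b \<in> carrier A\<rbrakk> \<Longrightarrow> f (a \<otimes>\<^bsub>A\<^esub> b) = f a \<otimes>\<^bsub>D\<^esub> f b"
  "\<lbrakk>a \<in> carrier A; b \<in> carrier A\<rbrakk> \<Longrightarrow> f (a \<oplus>\<^bsub>A\<^esub> b) = f a \<oplus>\<^bsub>D\<^esub> f b"
  "f \<one>\<^bsub>A\<^esub> = \<one>\<^bsub>D\<^esub>" "f \<zero>\<^bsub>A\<^esub> = \<zero>\<^bsub>D\<^esub>"
  and f_le_iff: "\<lbrakk>a \<in> carrier A; b \<in> carrier A\<rbrakk> \<Longrightarrow> f a \<preceq>\<^bsub>D\<^esub> f b \<longleftrightarrow> a \<preceq>\<^bsub>A\<^esub> b"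
  using D_fractions
  by (auto simp: comm_bimonoid_of_fractions_def bimonoid_embedding_def bimonoid_hom_def)

text \<open>The complement is a variable subject to \<open>is_complement\<close>, so later lemmas
  accept any description of it, such as a product of complements, without evaluating
  \<open>bm_compl\<close>.\<close>

lemma C_mult_fraction:
  assumes "x \<in> carrier C"
  obtains a b b' where "a \<in> carrier A" "b \<in> carrier A" "is_complement C (e b) b'"
    "x = e a \<otimes>\<^bsub>C\<^esub> b'"
  using assms C_fractions C.is_complement_bm_compl e_simps(1)
  unfolding comm_bimonoid_of_fractions_def by metis

lemma C_plus_fraction:
  assumes "x \<in> carrier C"
  obtains c d d' where "c \<in> carrier A" "d \<in> carrier A" "is_complement C (e d) d'"
    "x = e c \<oplus>\<^bsub>C\<^esub> d'"
  using assms C_fractions C.is_complement_bm_compl e_simps(1)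
  unfolding comm_bimonoid_of_fractions_def by metis

lemma D_mult_fraction:
  assumes "x \<in> carrier D"
  obtains a b b' where "a \<in> carrier A" "b \<in> carrier A" "is_complement D (f b) b'"
    "x = f a \<otimes>\<^bsub>D\<^esub> b'"
  using assms D_fractions D.is_complement_bm_compl f_simps(1)
  unfolding comm_bimonoid_of_fractions_def by metis

lemma D_plus_fraction:
  assumes "x \<in> carrier D"
  obtains c d d' where "c \<in> carrier A" "d \<in> carrier A" "is_complement D (f d) d'"
    "x = f c \<oplus>\<^bsub>D\<^esub> d'"
  using assms D_fractions D.is_complement_bm_compl f_simps(1)
  unfolding comm_bimonoid_of_fractions_def by metis

text \<open>The right-hand side lies in \<open>A\<close> and is the same as in
  \<open>D_fraction_le_iff\<close>; comparisons of this shape pass between \<open>C\<close> and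
  \<open>D\<close> through it.\<close>

lemma C_fraction_le_iff:
  assumes "a \<in> carrier A" "b \<in> carrier A" "c \<in> carrier A" "d \<in> carrier A"
    and "is_complement C (e b) b'" "is_complement C (e d) d'"
  shows "e a \<otimes>\<^bsub>C\<^esub> b' \<preceq>\<^bsub>C\<^esub> e c \<oplus>\<^bsub>C\<^esub> d' \<longleftrightarrow> a \<otimes>\<^bsub>A\<^esub> d \<preceq>\<^bsub>A\<^esub> b \<oplus>\<^bsub>A\<^esub> c"
  using C.fraction_le_iff[of "e a" "e b" "e c" "e d"] assms
    e_le_iff[of "a \<otimes>\<^bsub>A\<^esub> d" "b \<oplus>\<^bsub>A\<^esub> c"] by simp

lemma D_fraction_le_iff:
  assumes "a \<in> carrier A" "b \<in> carrier A" "c \<in> carrier A" "d \<in> carrier A"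
    and "is_complement D (f b) b'" "is_complement D (f d) d'"
  shows "f a \<otimes>\<^bsub>D\<^esub> b' \<preceq>\<^bsub>D\<^esub> f c \<oplus>\<^bsub>D\<^esub> d' \<longleftrightarrow> a \<otimes>\<^bsub>A\<^esub> d \<preceq>\<^bsub>A\<^esub> b \<oplus>\<^bsub>A\<^esub> c"
  using D.fraction_le_iff[of "f a" "f b" "f c" "f d"] assms
    f_le_iff[of "a \<otimes>\<^bsub>A\<^esub> d" "b \<oplus>\<^bsub>A\<^esub> c"] by simp

text \<open>This is what makes the extension independent of the chosen representation.\<close>

lemma fraction_eq_transfer:
  assumes [simp]: "a \<in> carrier A" "b \<in> carrier A" "c \<in> carrier A" "d \<in> carrier A"
    and Cb: "is_complement C (e b) b'" and Cd: "is_complement C (e d) d'"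
    and Db: "is_complement D (f b) b''" and Dd: "is_complement D (f d) d''"
    and eq: "e a \<otimes>\<^bsub>C\<^esub> b' = e c \<oplus>\<^bsub>C\<^esub> d'"
  shows "f a \<otimes>\<^bsub>D\<^esub> b'' = f c \<oplus>\<^bsub>D\<^esub> d''"
proof (rule D.le_antisymD)
  note [simp] = C.is_complement_closed[OF Cb] C.is_complement_closed[OF Cd]
    D.is_complement_closed[OF Db] D.is_complement_closed[OF Dd]
  show "f a \<otimes>\<^bsub>D\<^esub> b'' \<in> carrier D" "f c \<oplus>\<^bsub>D\<^esub> d'' \<in> carrier D"
    by simp_all
  have "e a \<otimes>\<^bsub>C\<^esub> b' \<preceq>\<^bsub>C\<^esub> e c \<oplus>\<^bsub>C\<^esub> d'"
    using eq by (metis C.le_self C.mult_closed C.is_complement_closed Cb assms(1) e_simps(1))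
  then show "f a \<otimes>\<^bsub>D\<^esub> b'' \<preceq>\<^bsub>D\<^esub> f c \<oplus>\<^bsub>D\<^esub> d''"
    using C_fraction_le_iff D_fraction_le_iff Cb Cd Db Dd assms(1-4) by blast
  \<comment> \<open>Each side is rewritten in \<open>D\<close> in the opposite shape, so that the
    remaining goal is a multiplicative fraction below an additive one, as
    \<open>D_fraction_le_iff\<close> requires.\<close>
  obtain p q q' where pq [simp]: "p \<in> carrier A" "q \<in> carrier A"
      and q': "is_complement D (f q) q'" and p_eq: "f c \<oplus>\<^bsub>D\<^esub> d'' = f p \<otimes>\<^bsub>D\<^esub> q'"
    by (rule D_mult_fraction[of "f c \<oplus>\<^bsub>D\<^esub> d''"]) simp_all
  obtain r s s' where rs [simp]: "r \<in> carrier A" "s \<in> carrier A"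
      and s': "is_complement D (f s) s'" and r_eq: "f a \<otimes>\<^bsub>D\<^esub> b'' = f r \<oplus>\<^bsub>D\<^esub> s'"
    by (rule D_plus_fraction[of "f a \<otimes>\<^bsub>D\<^esub> b''"]) simp_all
  define x where "x = e a \<otimes>\<^bsub>C\<^esub> b'"
  have [simp]: "x \<in> carrier C" by (simp add: x_def)
  have "f p \<otimes>\<^bsub>D\<^esub> q' \<preceq>\<^bsub>D\<^esub> f c \<oplus>\<^bsub>D\<^esub> d''"
    by (simp flip: p_eq)
  \<comment> \<open>The criterion descends from \<open>D\<close> to \<open>A\<close>, and
    \<open>e\<close> lifts the result to \<open>C\<close>. Without \<open>e_simps\<close>, the
    products and sums stay inside \<open>e\<close>, where \<open>e_le_iff\<close> matches
    them.\<close>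
  then have "e (p \<otimes>\<^bsub>A\<^esub> d) \<preceq>\<^bsub>C\<^esub> e (q \<oplus>\<^bsub>A\<^esub> c)"
    using D_fraction_le_iff[OF _ _ _ _ q' Dd, of p c] by (simp add: e_le_iff del: e_simps)
  then have "e p \<preceq>\<^bsub>C\<^esub> x \<oplus>\<^bsub>C\<^esub> e q"
    using C.le_plus_compl_iff[OF _ _ _ Cd, of "e p" "e q \<oplus>\<^bsub>C\<^esub> e c"]
    by (simp add: x_def eq C.plus_assoc C.plus_comm C.plus_left_comm)
  \<comment> \<open>Hemidistributivity acts as a cut rule: it joins the bounds on the two sides of
    \<open>x\<close> and eliminates \<open>x\<close>.\<close>
  then have "e p \<otimes>\<^bsub>C\<^esub> e s \<preceq>\<^bsub>C\<^esub> e s \<otimes>\<^bsub>C\<^esub> (x \<oplus>\<^bsub>C\<^esub> e q)"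
    using C.mult_mono[of "e p" "x \<oplus>\<^bsub>C\<^esub> e q" "e s" "e s"] by (simp add: C.mult_comm)
  moreover have "e s \<otimes>\<^bsub>C\<^esub> (x \<oplus>\<^bsub>C\<^esub> e q) \<preceq>\<^bsub>C\<^esub> (e s \<otimes>\<^bsub>C\<^esub> x) \<oplus>\<^bsub>C\<^esub> e q"
    by (simp add: C.hemidistrib_left)
  ultimately have 1: "e p \<otimes>\<^bsub>C\<^esub> e s \<preceq>\<^bsub>C\<^esub> (e s \<otimes>\<^bsub>C\<^esub> x) \<oplus>\<^bsub>C\<^esub> e q"
    by (rule C.le_transD) simp_all
  have "f a \<otimes>\<^bsub>D\<^esub> b'' \<preceq>\<^bsub>D\<^esub> f r \<oplus>\<^bsub>D\<^esub> s'"
    by (simp flip: r_eq)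
  then have "e (a \<otimes>\<^bsub>A\<^esub> s) \<preceq>\<^bsub>C\<^esub> e (b \<oplus>\<^bsub>A\<^esub> r)"
    using D_fraction_le_iff[OF _ _ _ _ Db s', of a r] by (simp add: e_le_iff del: e_simps)
  \<comment> \<open>Here \<open>x\<close> is used in its multiplicative form, whereas the bound on
    \<open>e p\<close> used its additive form.\<close>
  then have "e s \<otimes>\<^bsub>C\<^esub> x \<preceq>\<^bsub>C\<^esub> e r"
    using C.mult_compl_le_iff[OF _ _ _ Cb, of "e a \<otimes>\<^bsub>C\<^esub> e s" "e r"]
    by (simp add: x_def C.mult_assoc C.mult_comm C.mult_left_comm)
  then have "(e s \<otimes>\<^bsub>C\<^esub> x) \<oplus>\<^bsub>C\<^esub> e q \<preceq>\<^bsub>C\<^esub> e r \<oplus>\<^bsub>C\<^esub> e q"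
    by (intro C.plus_mono) simp_all
  with 1 have "e p \<otimes>\<^bsub>C\<^esub> e s \<preceq>\<^bsub>C\<^esub> e r \<oplus>\<^bsub>C\<^esub> e q"
    by (rule C.le_transD) simp_all
  then have "p \<otimes>\<^bsub>A\<^esub> s \<preceq>\<^bsub>A\<^esub> q \<oplus>\<^bsub>A\<^esub> r"
    using e_le_iff[of "p \<otimes>\<^bsub>A\<^esub> s" "q \<oplus>\<^bsub>A\<^esub> r"] by (simp add: C.plus_comm)
  then show "f c \<oplus>\<^bsub>D\<^esub> d'' \<preceq>\<^bsub>D\<^esub> f a \<otimes>\<^bsub>D\<^esub> b''"
    using D_fraction_le_iff[OF _ _ _ _ q' s', of p r] by (simp add: p_eq r_eq)
qed

section \<open>Construction of the extension\<close>

lemma D_compl: "a \<in> carrier A \<Longrightarrow> is_complement D (f a) (bm_compl D (f a))"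
  using D_complemented D.is_complement_bm_compl by (simp add: complemented_def)

text \<open>Choice fixes a value through some additive representation; independence of it is proved
  afterwards. The restriction to \<open>carrier C\<close> makes the map extensional, so that
  uniqueness can be stated as equality of functions.\<close>

definition extension :: "'c \<Rightarrow> 'd" where
  "extension = (\<lambda>x\<in>carrier C. SOME y. \<exists>c\<in>carrier A. \<exists>d\<in>carrier A.
     has_complement C (e d) \<and> x = e c \<oplus>\<^bsub>C\<^esub> bm_compl C (e d) \<and> y = f c \<oplus>\<^bsub>D\<^esub> bm_compl D (f d))"

lemma extension_SOME:
  assumes "x \<in> carrier C"
  obtains c d d' where "c \<in> carrier A" "d \<in> carrier A" "is_complement C (e d) d'"
    "x = e c \<oplus>\<^bsub>C\<^esub> d'" "extension x = f c \<oplus>\<^bsub>D\<^esub> bm_compl D (f d)"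
proof -
  let ?P = "\<lambda>y. \<exists>c\<in>carrier A. \<exists>d\<in>carrier A.
     has_complement C (e d) \<and> x = e c \<oplus>\<^bsub>C\<^esub> bm_compl C (e d) \<and> y = f c \<oplus>\<^bsub>D\<^esub> bm_compl D (f d)"
  have "\<exists>y. ?P y"
    using assms C_fractions unfolding comm_bimonoid_of_fractions_def by blast
  then have "?P (extension x)"
    using someI_ex[of ?P] assms by (simp add: extension_def)
  then show thesis
    using that C.is_complement_bm_compl e_simps(1) by metis
qed

text \<open>The given multiplicative fraction is compared with the additive one behind the chosen
  value.\<close>

lemma extension_mult_fraction:
  assumes a: "a \<in> carrier A" and b: "b \<in> carrier A"
    and b': "is_complement C (e b) b'" and b'': "is_complement D (f b) b''"
  shows "extension (e a \<otimes>\<^bsub>C\<^esub> b') = f a \<otimes>\<^bsub>D\<^esub> b''"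
proof -
  have "e a \<otimes>\<^bsub>C\<^esub> b' \<in> carrier C"
    using a C.is_complement_closed[OF b'] by simp
  then obtain c d d' where cd: "c \<in> carrier A" "d \<in> carrier A" "is_complement C (e d) d'"
    "e a \<otimes>\<^bsub>C\<^esub> b' = e c \<oplus>\<^bsub>C\<^esub> d'" "extension (e a \<otimes>\<^bsub>C\<^esub> b') = f c \<oplus>\<^bsub>D\<^esub> bm_compl D (f d)"
    by (rule extension_SOME)
  then show ?thesis
    using fraction_eq_transfer[OF a b cd(1,2) b' cd(3) b'' D_compl] by simp
qed

text \<open>Transfer compares only fractions of opposite shapes, so two additive representations are
  linked through a multiplicative one.\<close>

lemma extension_plus_fraction:
  assumes c: "c \<in> carrier A" and d: "d \<in> carrier A"
    and d': "is_complement C (e d) d'" and d'': "is_complement D (f d) d''"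
  shows "extension (e c \<oplus>\<^bsub>C\<^esub> d') = f c \<oplus>\<^bsub>D\<^esub> d''"
proof -
  have "e c \<oplus>\<^bsub>C\<^esub> d' \<in> carrier C"
    using c C.is_complement_closed[OF d'] by simp
  then obtain a b b' where ab: "a \<in> carrier A" "b \<in> carrier A" "is_complement C (e b) b'"
    "e c \<oplus>\<^bsub>C\<^esub> d' = e a \<otimes>\<^bsub>C\<^esub> b'"
    by (rule C_mult_fraction)
  then show ?thesis
    using fraction_eq_transfer[OF ab(1,2) c d ab(3) d' D_compl d'']
      extension_mult_fraction[OF ab(1-3) D_compl] by simp
qed

lemma extension_closed: "x \<in> carrier C \<Longrightarrow> extension x \<in> carrier D"
  by (elim extension_SOME) (simp add: D.is_complement_closed[OF D_compl])

lemma extension_e: "a \<in> carrier A \<Longrightarrow> extension (e a) = f a"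
  \<comment> \<open>The element \<open>e a\<close> is the fraction with denominator \<zero>, whose
    complement is \<one>.\<close>
  using extension_mult_fraction[of a "\<zero>\<^bsub>A\<^esub>" "\<one>\<^bsub>C\<^esub>" "\<one>\<^bsub>D\<^esub>"]
  by (simp add: C.is_complement_zero_one D.is_complement_zero_one)

section \<open>Order and operations under the extension\<close>

text \<open>With \<open>x\<close> multiplicative and \<open>y\<close> additive, both comparisons
  reduce to the same inequality in \<open>A\<close>.\<close>

lemma extension_le_iff:
  assumes "x \<in> carrier C" "y \<in> carrier C"
  shows "extension x \<preceq>\<^bsub>D\<^esub> extension y \<longleftrightarrow> x \<preceq>\<^bsub>C\<^esub> y"
proof -
  obtain a b b' where x: "a \<in> carrier A" "b \<in> carrier A" "is_complement C (e b) b'"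
      "x = e a \<otimes>\<^bsub>C\<^esub> b'"
    using C_mult_fraction assms(1) .
  obtain c d d' where y: "c \<in> carrier A" "d \<in> carrier A" "is_complement C (e d) d'"
      "y = e c \<oplus>\<^bsub>C\<^esub> d'"
    using C_plus_fraction assms(2) .
  show ?thesis
    unfolding x(4) y(4) extension_mult_fraction[OF x(1-3) D_compl[OF x(2)]]
      extension_plus_fraction[OF y(1-3) D_compl[OF y(2)]]
      C_fraction_le_iff[OF x(1,2) y(1,2) x(3) y(3)]
    by (rule D_fraction_le_iff[OF x(1,2) y(1,2) D_compl[OF x(2)] D_compl[OF y(2)]])
qed

text \<open>Products preserve the multiplicative shape: the numerators multiply, and by De Morgan b'
  \<otimes> d' is the complement of the sum of the denominators, in \<open>C\<close> and in
  \<open>D\<close> alike.\<close>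

lemma extension_mult:
  assumes "x \<in> carrier C" "y \<in> carrier C"
  shows "extension (x \<otimes>\<^bsub>C\<^esub> y) = extension x \<otimes>\<^bsub>D\<^esub> extension y"
proof -
  obtain a b b' where x: "a \<in> carrier A" "b \<in> carrier A" "is_complement C (e b) b'"
      "x = e a \<otimes>\<^bsub>C\<^esub> b'"
    using C_mult_fraction assms(1) .
  obtain c d d' where y: "c \<in> carrier A" "d \<in> carrier A" "is_complement C (e d) d'"
      "y = e c \<otimes>\<^bsub>C\<^esub> d'"
    using C_mult_fraction assms(2) .
  let ?b = "bm_compl D (f b)" and ?d = "bm_compl D (f d)"
  note [simp] = x(1,2) y(1,2) C.is_complement_closed[OF x(3)] C.is_complement_closed[OF y(3)]
    D.is_complement_closed[OF D_compl[OF x(2)]] D.is_complement_closed[OF D_compl[OF y(2)]]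
  have eq: "x \<otimes>\<^bsub>C\<^esub> y = e (a \<otimes>\<^bsub>A\<^esub> c) \<otimes>\<^bsub>C\<^esub> (b' \<otimes>\<^bsub>C\<^esub> d')"
    by (simp add: x(4) y(4) C.mult_assoc C.mult_left_comm)
  have cC: "is_complement C (e (b \<oplus>\<^bsub>A\<^esub> d)) (b' \<otimes>\<^bsub>C\<^esub> d')"
    using C.is_complement_plus[OF _ _ x(3) y(3)] by simp
  have cD: "is_complement D (f (b \<oplus>\<^bsub>A\<^esub> d)) (?b \<otimes>\<^bsub>D\<^esub> ?d)"
    using D.is_complement_plus[OF _ _ D_compl[OF x(2)] D_compl[OF y(2)]] by simp
  have "extension (x \<otimes>\<^bsub>C\<^esub> y) = f (a \<otimes>\<^bsub>A\<^esub> c) \<otimes>\<^bsub>D\<^esub> (?b \<otimes>\<^bsub>D\<^esub> ?d)"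
    unfolding eq by (rule extension_mult_fraction[OF _ _ cC cD]) simp_all
  also have "\<dots> = (f a \<otimes>\<^bsub>D\<^esub> ?b) \<otimes>\<^bsub>D\<^esub> (f c \<otimes>\<^bsub>D\<^esub> ?d)"
    by (simp add: D.mult_assoc D.mult_left_comm)
  also have "\<dots> = extension x \<otimes>\<^bsub>D\<^esub> extension y"
    using extension_mult_fraction[OF x(1-3) D_compl[OF x(2)]]
      extension_mult_fraction[OF y(1-3) D_compl[OF y(2)]] by (simp add: x(4) y(4))
  finally show ?thesis .
qed

text \<open>Dually, sums preserve the additive shape, and the denominators multiply.\<close>

lemma extension_plus:
  assumes "x \<in> carrier C" "y \<in> carrier C"
  shows "extension (x \<oplus>\<^bsub>C\<^esub> y) = extension x \<oplus>\<^bsub>D\<^esub> extension y"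
proof -
  obtain a b b' where x: "a \<in> carrier A" "b \<in> carrier A" "is_complement C (e b) b'"
      "x = e a \<oplus>\<^bsub>C\<^esub> b'"
    using C_plus_fraction assms(1) .
  obtain c d d' where y: "c \<in> carrier A" "d \<in> carrier A" "is_complement C (e d) d'"
      "y = e c \<oplus>\<^bsub>C\<^esub> d'"
    using C_plus_fraction assms(2) .
  let ?b = "bm_compl D (f b)" and ?d = "bm_compl D (f d)"
  note [simp] = x(1,2) y(1,2) C.is_complement_closed[OF x(3)] C.is_complement_closed[OF y(3)]
    D.is_complement_closed[OF D_compl[OF x(2)]] D.is_complement_closed[OF D_compl[OF y(2)]]
  have eq: "x \<oplus>\<^bsub>C\<^esub> y = e (a \<oplus>\<^bsub>A\<^esub> c) \<oplus>\<^bsub>C\<^esub> (b' \<oplus>\<^bsub>C\<^esub> d')"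
    by (simp add: x(4) y(4) C.plus_assoc C.plus_left_comm)
  have cC: "is_complement C (e (b \<otimes>\<^bsub>A\<^esub> d)) (b' \<oplus>\<^bsub>C\<^esub> d')"
    using C.is_complement_mult[OF _ _ x(3) y(3)] by simp
  have cD: "is_complement D (f (b \<otimes>\<^bsub>A\<^esub> d)) (?b \<oplus>\<^bsub>D\<^esub> ?d)"
    using D.is_complement_mult[OF _ _ D_compl[OF x(2)] D_compl[OF y(2)]] by simp
  have "extension (x \<oplus>\<^bsub>C\<^esub> y) = f (a \<oplus>\<^bsub>A\<^esub> c) \<oplus>\<^bsub>D\<^esub> (?b \<oplus>\<^bsub>D\<^esub> ?d)"
    unfolding eq by (rule extension_plus_fraction[OF _ _ cC cD]) simp_all
  also have "\<dots> = (f a \<oplus>\<^bsub>D\<^esub> ?b) \<oplus>\<^bsub>D\<^esub> (f c \<oplus>\<^bsub>D\<^esub> ?d)"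
    by (simp add: D.plus_assoc D.plus_left_comm)
  also have "\<dots> = extension x \<oplus>\<^bsub>D\<^esub> extension y"
    using extension_plus_fraction[OF x(1-3) D_compl[OF x(2)]]
      extension_plus_fraction[OF y(1-3) D_compl[OF y(2)]] by (simp add: x(4) y(4))
  finally show ?thesis .
qed

lemma extension_embedding: "bimonoid_embedding C D extension"
  using extension_e[of "\<one>\<^bsub>A\<^esub>"] extension_e[of "\<zero>\<^bsub>A\<^esub>"]
  by (simp add: bimonoid_embedding_def bimonoid_hom_def extension_closed extension_le_iff
      extension_mult extension_plus)

section \<open>Uniqueness and the final statement\<close>

text \<open>Homomorphisms preserve complements, so \<open>h b'\<close> must be the complement of
  \<open>f b\<close>, which determines \<open>h\<close> on multiplicative fractions.\<close>

lemma hom_eq_extension: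
  assumes hom: "bimonoid_hom C D h" and h_e: "\<And>a. a \<in> carrier A \<Longrightarrow> h (e a) = f a"
    and x: "x \<in> carrier C"
  shows "h x = extension x"
proof -
  obtain a b b' where ab: "a \<in> carrier A" "b \<in> carrier A" "is_complement C (e b) b'"
      "x = e a \<otimes>\<^bsub>C\<^esub> b'"
    using C_mult_fraction x .
  have "is_complement D (f b) (h b')"
    using bimonoid_hom_is_complement[OF C.bimonoid_axioms hom _ ab(3)] h_e[OF ab(2)] ab(2) by simp
  then have "extension x = f a \<otimes>\<^bsub>D\<^esub> h b'"
    using extension_mult_fraction ab by simp
  moreover have "h x = f a \<otimes>\<^bsub>D\<^esub> h b'"
    using hom ab h_e C.is_complement_closed by (simp add: bimonoid_hom_def)
  ultimately show ?thesis by simp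
qed

theorem ex1_extension:
  "\<exists>!h. h \<in> carrier C \<rightarrow>\<^sub>E carrier D \<and> bimonoid_embedding C D h \<and>
     (\<forall>a\<in>carrier A. h (e a) = f a)"
proof (rule ex1I)
  have "extension \<in> carrier C \<rightarrow>\<^sub>E carrier D"
    using extension_closed by (auto simp: extension_def)
  then show "extension \<in> carrier C \<rightarrow>\<^sub>E carrier D \<and> bimonoid_embedding C D extension \<and>
      (\<forall>a\<in>carrier A. extension (e a) = f a)"
    using extension_embedding extension_e by blast
next
  fix h
  assume h: "h \<in> carrier C \<rightarrow>\<^sub>E carrier D \<and> bimonoid_embedding C D h \<and>
    (\<forall>a\<in>carrier A. h (e a) = f a)"
  show "h = extension"
  proof
    fix x
    show "h x = extension x"
    proof (cases "x \<in> carrier C")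
      case True
      then show ?thesis
        using h hom_eq_extension by (simp add: bimonoid_embedding_def)
    next
      \<comment> \<open>Both maps are extensional, so both are \<open>undefined\<close>
        here.\<close>
      case False
      then show ?thesis
        using h by (auto simp: extension_def)
    qed
  qed
qed

end

theorem mainTheorem11:
  fixes A :: "('a, 'k) bimonoid_scheme" and B :: "('b, 'l) bimonoid_scheme"
    and Abar :: "('c, 'm) bimonoid_scheme" and Bbar :: "('d, 'n) bimonoid_scheme"
    and \<iota> :: "'a \<Rightarrow> 'b" and e\<^sub>A :: "'a \<Rightarrow> 'c" and e\<^sub>B :: "'b \<Rightarrow> 'd"
  assumes "comm_bimonoid A" and "comm_bimonoid B"
    and "bimonoid_iso A B \<iota>"
    and "comm_bimonoid_of_fractions A Abar e\<^sub>A"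
    and "comm_bimonoid_of_fractions B Bbar e\<^sub>B"
    and "complemented Bbar"
  shows "\<exists>!h. h \<in> carrier Abar \<rightarrow>\<^sub>E carrier Bbar \<and> bimonoid_embedding Abar Bbar h \<and>
           (\<forall>a\<in>carrier A. h (e\<^sub>A a) = e\<^sub>B (\<iota> a))"
proof -
  \<comment> \<open>Precomposing with \<iota> makes \<open>Bbar\<close> a bimonoid of fractions of
    \<open>A\<close> itself, so both structures share one base.\<close>
  have "comm_bimonoid_of_fractions A Bbar (e\<^sub>B \<circ> \<iota>)"
    using assms by (intro comm_bimonoid_of_fractions_comp_iso)
  with assms interpret fractions_extension A Abar Bbar e\<^sub>A "e\<^sub>B \<circ> \<iota>"
    by (simp add: fractions_extension_def fractions_extension_axioms_def
        comm_bimonoid_of_fractions_def)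
  show ?thesis
    using ex1_extension by simp
qed

end
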